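(* For all integers $n>3$, we have $b_{3,2}(n)\geq b_{2,2}(n)$.
   Context: A partition of a positive integer $n$ is a finite non-increasing sequence of positive integers $\lambda=(\lambda_1,\lambda_2,\ldots,\lambda_r)$ with $\lambda_1+\cdots+\lambda_r=n$. The Young diagram of $\lambda$ is the left-justified array of boxes whose $i$-th row from the top has $\lambda_i$ boxes. The hook length of a box in a Young diagram is the number of boxes directly to its right (in the same row) plus the number of boxes directly below it (in the same column) plus $1$ (for the box itself). For an integer $t\geq 2$, a $t$-regular partition of $n$ is a partition of $n$ none of whose parts is divisible by $t$. For integers $t\geq 2$ and $k\geq 1$, $b_{t,k}(n)$ denotes the number of hooks of length $k$ in all the $t$-regular partitions of $n$, i.e. the sum over all $t$-regular partitions $\lambda$ of $n$ of the number of boxes in the Young diagram of $\lambda$ with hook length equal to $k$. *)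

theory Defs
  imports Main
begin

definition partitions :: "nat \<Rightarrow> nat list set" where
  "partitions n = {p. sorted_wrt (\<ge>) p \<and> (\<forall>x\<in>set p. 0 < x) \<and> sum_list p = n}"

definition regular_partitions :: "nat \<Rightarrow> nat \<Rightarrow> nat list set" where
  "regular_partitions t n = {p \<in> partitions n. \<forall>x\<in>set p. \<not> t dvd x}"

text \<open>Boxes are pairs (row, column), both counted from 0.\<close>

definition young_diagram :: "nat list \<Rightarrow> (nat \<times> nat) set" where
  "young_diagram p = {(i, j). i < length p \<and> j < p ! i}"

definition hook_length :: "nat list \<Rightarrow> nat \<times> nat \<Rightarrow> nat" where
  "hook_length p = (\<lambda>(i, j).
     card {j'. j < j' \<and> (i, j') \<in> young_diagram p} +
     card {i'. i < i' \<and> (i', j) \<in> young_diagram p} + 1)"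

definition hooks :: "nat \<Rightarrow> nat \<Rightarrow> nat \<Rightarrow> nat" where
  "hooks t k n =
     (\<Sum>p\<in>regular_partitions t n. card {b \<in> young_diagram p. hook_length p b = k})"

text \<open>The sets that are summed over and counted are finite, so none of the sums or
  cardinalities above takes its default value 0.\<close>

lemma finite_partitions: "finite (partitions n)"
proof (rule finite_subset)
  show "partitions n \<subseteq> {p. set p \<subseteq> {..n} \<and> length p \<le> n}"
  proof
    fix p assume "p \<in> partitions n"
    then have pos: "\<forall>x\<in>set p. 0 < x" and s: "sum_list p = n"
      by (auto simp: partitions_def)
    have "length p \<le> sum_list p"
      using pos by (induction p) (auto simp: Suc_le_eq intro: add_less_le_mono)
    then show "p \<in> {p. set p \<subseteq> {..n} \<and> length p \<le> n}"
      using s member_le_sum_list by auto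
  qed
  show "finite {p. set p \<subseteq> {..n} \<and> length p \<le> n}"
    by (rule finite_lists_length_le) simp
qed

lemma finite_regular_partitions: "finite (regular_partitions t n)"
  unfolding regular_partitions_def using finite_partitions by simp

lemma finite_young_diagram: "finite (young_diagram p)"
proof -
  have "young_diagram p = (SIGMA i:{..<length p}. {..<p ! i})"
    by (auto simp: young_diagram_def)
  then show ?thesis by simp
qed

lemma finite_arm: "finite {j'. j < j' \<and> (i, j') \<in> young_diagram p}"
  by (rule finite_subset[of _ "{..<p ! i}"]) (auto simp: young_diagram_def)

lemma finite_leg: "finite {i'. i < i' \<and> (i', j) \<in> young_diagram p}"
  by (rule finite_subset[of _ "{..<length p}"]) (auto simp: young_diagram_def)

end

theory Submission
  imports Defs "HOL-Library.Multiset"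
begin

text \<open>
  A box has hook length 2 iff its arm is 1 and its leg 0, or its arm is 0 and its leg 1. Hence the
  number of such boxes of a partition is the number of parts \<open>s \<ge> 2\<close> (without multiplicity) such
  that \<open>s - 1\<close> is not a part, plus the number of repeated part sizes. Write \<open>P\<^sub>t\<close> for the generating
  function of the \<open>t\<close>-regular partitions. Summing over all of them, the generating function of the
  hook counts is \<open>G\<^sub>t P\<^sub>t\<close> for an explicit rational function \<open>G\<^sub>t\<close>. Since \<open>G\<^sub>2\<close> has nonnegative
  coefficients and \<open>P\<^sub>2 \<le> P\<^sub>3\<close> coefficientwise, it suffices to bound the coefficients of
  \<open>(G\<^sub>3 - G\<^sub>2) P\<^sub>3\<close>, where
  \<open>G\<^sub>3 - G\<^sub>2 = (q^2 - 2 q^3 + 2 q^4 - q^6 + 2 q^8 - 2 q^9 + q^10) / (1 - q^12)\<close>.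
  The numerator is \<open>q^2 (1 - q) (1 - q + q^2 + q^3) + 2 q^8 (1 - q) + q^10\<close>, and its product with
  \<open>P\<^sub>3\<close> has only one negative coefficient, namely \<open>-1\<close> at \<open>q^3\<close>. The division by
  \<open>1 - q^12\<close> repeats it at the exponents 15, 27, 39 and so on, where the term \<open>q^10 P\<^sub>3\<close> makes up for it.
\<close>

section \<open>Multisets of parts from a given set and their counting function\<close>

declare of_nat_sum_mset [simp del]

text \<open>With multisets, adding or removing parts is plain multiset arithmetic. The total
  \<open>i\<close> is an integer, so that a shifted coefficient with negative index vanishes instead
  of being truncated to index 0.\<close>

definition parts_from :: "nat set \<Rightarrow> int \<Rightarrow> nat multiset set" where
  "parts_from A i = {M. set_mset M \<subseteq> A \<and> int (sum_mset M) = i}"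

text \<open>For \<open>0 \<notin> A\<close> this is the coefficient of \<open>q^i\<close> in the
  product of \<open>1 / (1 - q^a)\<close> over \<open>a \<in> A\<close>.\<close>

definition num_parts :: "nat set \<Rightarrow> int \<Rightarrow> int" where
  "num_parts A i = int (card (parts_from A i))"

lemma inj_on_mset_partitions: "inj_on mset (partitions n)"
proof (rule inj_onI)
  fix p q assume p: "p \<in> partitions n" and q: "q \<in> partitions n" and eq: "mset p = mset q"
  have "sorted (rev p)" "sorted (rev q)"
    using p q by (auto simp: partitions_def sorted_wrt_rev)
  moreover have "mset (rev p) = mset (rev q)" using eq by simp
  ultimately have "rev p = rev q"
    by (metis properties_for_sort)
  then show "p = q" by simp
qed

lemma parts_from_eq_image:
  assumes "0 \<notin> A"
  shows "parts_from A (int n) = mset ` {p \<in> partitions n. set p \<subseteq> A}"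
proof (intro equalityI subsetI)
  fix M assume M: "M \<in> parts_from A (int n)"
  let ?p = "rev (sorted_list_of_multiset M)"
  have "M = mset ?p" by simp
  moreover have "sorted_wrt (\<ge>) ?p"
    by (simp add: sorted_wrt_rev)
  moreover have "set ?p \<subseteq> A" "sum_list ?p = n"
    using M by (auto simp: parts_from_def sum_mset_sum_list[symmetric])
  moreover have "\<forall>x\<in>set ?p. 0 < x"
    using \<open>set ?p \<subseteq> A\<close> assms by (metis gr0I subsetD)
  ultimately show "M \<in> mset ` {p \<in> partitions n. set p \<subseteq> A}"
    unfolding partitions_def by blast
next
  fix M assume "M \<in> mset ` {p \<in> partitions n. set p \<subseteq> A}"
  then show "M \<in> parts_from A (int n)"
    by (auto simp: parts_from_def partitions_def sum_mset_sum_list)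
qed

lemma parts_from_neg: "i < 0 \<Longrightarrow> parts_from A i = {}"
  by (auto simp: parts_from_def)

lemma num_parts_neg: "i < 0 \<Longrightarrow> num_parts A i = 0"
  by (simp add: num_parts_def parts_from_neg)

lemma num_parts_nonneg: "num_parts A i \<ge> 0"
  by (simp add: num_parts_def)

lemma finite_parts_from:
  assumes "0 \<notin> A"
  shows "finite (parts_from A i)"
proof (cases "i < 0")
  case False
  then obtain n where "i = int n" by (metis nonneg_int_cases not_less)
  then show ?thesis
    using parts_from_eq_image[OF assms] finite_partitions by simp
qed (simp add: parts_from_neg)

text \<open>Adding \<open>X\<close> is a bijection onto the multisets that contain \<open>X\<close>;
  for generating functions it is multiplication by a power of \<open>q\<close>.\<close>

lemma card_parts_from_superset:
  assumes "set_mset X \<subseteq> A"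
  shows "int (card {M \<in> parts_from A i. X \<subseteq># M}) = num_parts A (i - int (sum_mset X))"
proof -
  have "bij_betw ((+) X) (parts_from A (i - int (sum_mset X))) {M \<in> parts_from A i. X \<subseteq># M}"
    unfolding bij_betw_def
  proof
    show "(+) X ` parts_from A (i - int (sum_mset X)) = {M \<in> parts_from A i. X \<subseteq># M}"
    proof (intro equalityI subsetI)
      fix M assume "M \<in> {M \<in> parts_from A i. X \<subseteq># M}"
      moreover from this obtain N where "M = X + N"
        by (auto simp: mset_subset_eq_exists_conv)
      ultimately show "M \<in> (+) X ` parts_from A (i - int (sum_mset X))"
        by (auto simp: parts_from_def)
    qed (use assms in \<open>auto simp: parts_from_def\<close>)
  qed simp
  then show ?thesis
    by (metis num_parts_def bij_betw_same_card)
qed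

text \<open>Either \<open>a\<close> does not occur, or one copy of it can be taken out. For
  generating functions: multiplication by \<open>1 - q^a\<close> removes \<open>a\<close> from the
  admissible parts.\<close>

lemma num_parts_remove:
  assumes "0 \<notin> A" "a \<in> A"
  shows "num_parts A i = num_parts (A - {a}) i + num_parts A (i - int a)"
proof -
  have "parts_from A i = parts_from (A - {a}) i \<union> {M \<in> parts_from A i. {#a#} \<subseteq># M}"
    by (auto simp: parts_from_def)
  moreover have "parts_from (A - {a}) i \<inter> {M \<in> parts_from A i. {#a#} \<subseteq># M} = {}"
    by (auto simp: parts_from_def)
  ultimately have "card (parts_from A i) =
      card (parts_from (A - {a}) i) + card {M \<in> parts_from A i. {#a#} \<subseteq># M}"
    using finite_parts_from[of A i] finite_parts_from[of "A - {a}" i] assms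
    by (metis (lifting) card_Un_disjoint finite_Un)
  then show ?thesis
    using card_parts_from_superset[of "{#a#}" A i] assms by (simp add: num_parts_def)
qed

lemma num_parts_pos:
  assumes "0 \<notin> A" "1 \<in> A" "i \<ge> 0"
  shows "num_parts A i \<ge> 1"
proof -
  have "replicate_mset (nat i) 1 \<in> parts_from A i"
    using assms by (auto simp: parts_from_def)
  then have "card (parts_from A i) > 0"
    using finite_parts_from[OF assms(1)] card_gt_0_iff by blast
  then show ?thesis by (simp add: num_parts_def)
qed

section \<open>Boxes of hook length 2 in a single partition\<close>

definition mset_hooks2 :: "nat multiset \<Rightarrow> nat" where
  "mset_hooks2 M = card {s \<in> set_mset M. 2 \<le> s \<and> s - 1 \<notin># M} + card {s. 2 \<le> count M s}"

lemma finite_count_ge_2: "finite {s. 2 \<le> count M s}"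
  by (rule finite_subset[of _ "set_mset M"]) (auto simp: count_greater_zero_iff[symmetric] simp del: count_greater_zero_iff)

text \<open>Arms and legs never look upward, so deleting the top row only renumbers the
  rows.\<close>

lemma hook_length_Cons_Suc: "hook_length (x # q) (Suc i, j) = hook_length q (i, j)"
proof -
  have "{i'. Suc i < i' \<and> (i', j) \<in> young_diagram (x # q)} =
      Suc ` {i'. i < i' \<and> (i', j) \<in> young_diagram q}"
    by (auto simp: young_diagram_def image_iff gr0_conv_Suc less_Suc_eq_0_disj)
  then show ?thesis
    by (simp add: hook_length_def young_diagram_def card_image)
qed

lemma hook_length_Cons_0:
  "hook_length (x # q) (0, j) = (x - 1 - j) + length (filter (\<lambda>y. j < y) q) + 1"
proof -
  have "{i'. 0 < i' \<and> (i', j) \<in> young_diagram (x # q)} = Suc ` {i. i < length q \<and> j < q ! i}"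
    by (auto simp: young_diagram_def image_iff gr0_conv_Suc)
  moreover have "{j'. j < j' \<and> (0, j') \<in> young_diagram (x # q)} = {j<..<x}"
    by (auto simp: young_diagram_def)
  ultimately show ?thesis
    by (simp add: hook_length_def card_image length_filter_conv_card)
qed

text \<open>Only two boxes of the longest row qualify: column \<open>x - 2\<close> with leg 0, which
  means that no other part is \<open>x\<close> or \<open>x - 1\<close>, and column
  \<open>x - 1\<close> with leg 1, which means that exactly one other part is
  \<open>x\<close>.\<close>

lemma card_hooks2_row_0:
  assumes "0 < x" "\<forall>y\<in>set q. y \<le> x"
  shows "card {j. j < x \<and> hook_length (x # q) (0, j) = 2} =
    of_bool (2 \<le> x \<and> x \<notin># mset q \<and> x - 1 \<notin># mset q) + of_bool (count (mset q) x = 1)"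
proof -
  let ?A = "{j. j = x - 2 \<and> 2 \<le> x \<and> x \<notin># mset q \<and> x - 1 \<notin># mset q}"
  let ?B = "{j. j = x - 1 \<and> count (mset q) x = 1}"
  have leg0: "filter (\<lambda>y. x - 2 < y) q = [] \<longleftrightarrow> x \<notin># mset q \<and> x - 1 \<notin># mset q" if "2 \<le> x"
  proof -
    have "x - 2 < y \<longleftrightarrow> y = x \<or> y = x - 1" if "y \<in> set q" for y
      using \<open>2 \<le> x\<close> assms(2) that by force
    then show ?thesis by (auto simp: filter_empty_conv)
  qed
  have "filter (\<lambda>y. x - 1 < y) q = filter ((=) x) q"
    using assms by (intro filter_cong) force+
  then have leg1: "length (filter (\<lambda>y. x - 1 < y) q) = count (mset q) x"
    by (simp add: count_mset count_list_eq_length_filter)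
  have "{j. j < x \<and> hook_length (x # q) (0, j) = 2} = ?A \<union> ?B"
  proof (intro set_eqI)
    fix j
    have "j < x \<and> hook_length (x # q) (0, j) = 2 \<longleftrightarrow>
        j < x \<and> (j = x - 2 \<and> 2 \<le> x \<and> filter (\<lambda>y. j < y) q = [] \<or>
                  j = x - 1 \<and> length (filter (\<lambda>y. j < y) q) = 1)"
      unfolding hook_length_Cons_0 length_0_conv[symmetric] by arith
    also have "\<dots> \<longleftrightarrow> j \<in> ?A \<union> ?B"
      using leg0 leg1 assms(1) by auto
    finally show "j \<in> {j. j < x \<and> hook_length (x # q) (0, j) = 2} \<longleftrightarrow> j \<in> ?A \<union> ?B"
      by simp
  qed
  moreover have "?A \<inter> ?B = {}" by auto
  moreover have "finite ?A" "finite ?B" by simp_all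
  moreover have "card ?A = of_bool (2 \<le> x \<and> x \<notin># mset q \<and> x - 1 \<notin># mset q)"
    by (cases "2 \<le> x \<and> x \<notin># mset q \<and> x - 1 \<notin># mset q") auto
  moreover have "card ?B = of_bool (count (mset q) x = 1)"
    by (cases "count (mset q) x = 1") auto
  ultimately show ?thesis by (simp add: card_Un_disjoint)
qed

text \<open>The increment is the count of \<open>card_hooks2_row_0\<close>. A second copy of
  \<open>x\<close> creates a repeated size, a new \<open>x\<close> may create a size without
  predecessor, and no smaller size \<open>s\<close> is affected, because \<open>s - 1\<close>
  differs from \<open>x\<close>.\<close>

lemma mset_hooks2_add:
  assumes "0 < x" "\<forall>y\<in>#M. y \<le> x"
  shows "mset_hooks2 (add_mset x M) = mset_hooks2 M +
    (of_bool (2 \<le> x \<and> x \<notin># M \<and> x - 1 \<notin># M) + of_bool (count M x = 1))"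
proof (cases "x \<in># M")
  case True
  then have 1: "{s \<in> set_mset (add_mset x M). 2 \<le> s \<and> s - 1 \<notin># add_mset x M} =
      {s \<in> set_mset M. 2 \<le> s \<and> s - 1 \<notin># M}"
    by auto
  have 2: "{s. 2 \<le> count (add_mset x M) s} = insert x {s. 2 \<le> count M s}"
    using True by (auto simp: Suc_le_eq)
  show ?thesis
  proof (cases "count M x = 1")
    case True
    then show ?thesis
      using \<open>x \<in># M\<close> unfolding mset_hooks2_def 1 2 by (simp add: finite_count_ge_2)
  next
    case False
    then have "2 \<le> count M x"
      using \<open>x \<in># M\<close> by (metis One_nat_def Suc_1 Suc_leI count_greater_zero_iff le_neq_implies_less)
    then have "insert x {s. 2 \<le> count M s} = {s. 2 \<le> count M s}" by auto
    then show ?thesis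
      using \<open>x \<in># M\<close> False unfolding mset_hooks2_def 1 2 by simp
  qed
next
  case False
  then have c0: "count M x = 0" by (simp add: not_in_iff)
  have "s < x" if "s \<in># M" for s
    using that assms(2) False by (metis le_neq_implies_less)
  then have 1: "{s \<in> set_mset (add_mset x M). 2 \<le> s \<and> s - 1 \<notin># add_mset x M} =
      {s. s = x \<and> 2 \<le> x \<and> x - 1 \<notin># M} \<union> {s \<in> set_mset M. 2 \<le> s \<and> s - 1 \<notin># M}"
    using assms(1) by fastforce
  have "card \<dots> = card {s. s = x \<and> 2 \<le> x \<and> x - 1 \<notin># M} +
      card {s \<in> set_mset M. 2 \<le> s \<and> s - 1 \<notin># M}"
    using False by (intro card_Un_disjoint) auto
  moreover have "{s. 2 \<le> count (add_mset x M) s} = {s. 2 \<le> count M s}"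
    using False by (auto simp: c0 split: if_splits)
  moreover have "card {s. s = x \<and> 2 \<le> x \<and> x - 1 \<notin># M} =
      of_bool (2 \<le> x \<and> x \<notin># M \<and> x - 1 \<notin># M)"
    using False by (cases "2 \<le> x \<and> x - 1 \<notin># M") auto
  ultimately show ?thesis
    using False unfolding mset_hooks2_def 1 by (simp add: c0)
qed

text \<open>Induction on the rows from the bottom up: each new top row is a largest part, so both
  counts grow by the same amount.\<close>

lemma card_hooks2_eq:
  assumes "sorted_wrt (\<ge>) p" "\<forall>x\<in>set p. 0 < x"
  shows "card {b \<in> young_diagram p. hook_length p b = 2} = mset_hooks2 (mset p)"
  using assms
proof (induction p)
  case Nil
  show ?case by (simp add: young_diagram_def mset_hooks2_def)
next
  case (Cons x q)
  let ?R = "Pair 0 ` {j. j < x \<and> hook_length (x # q) (0, j) = 2}"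
  let ?S = "map_prod Suc id ` {b \<in> young_diagram q. hook_length q b = 2}"
  have "b \<in> {b \<in> young_diagram (x # q). hook_length (x # q) b = 2} \<longleftrightarrow> b \<in> ?R \<union> ?S" for b
  proof (cases b)
    case (Pair i j)
    then show ?thesis
      by (cases i) (auto simp: young_diagram_def hook_length_Cons_Suc image_iff)
  qed
  then have "{b \<in> young_diagram (x # q). hook_length (x # q) b = 2} = ?R \<union> ?S" by blast
  moreover have "?R \<inter> ?S = {}" by auto
  moreover have "finite ?R" "finite ?S" using finite_young_diagram by auto
  moreover have "card ?R = card {j. j < x \<and> hook_length (x # q) (0, j) = 2}"
    by (rule card_image) (simp add: inj_on_def)
  moreover have "card ?S = card {b \<in> young_diagram q. hook_length q b = 2}"
    by (rule card_image) (auto simp: inj_on_def)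
  ultimately show ?case
    using Cons by (simp add: card_Un_disjoint card_hooks2_row_0 mset_hooks2_add)
qed

section \<open>Double counting over all regular partitions\<close>

lemma hooks2_eq_sum:
  assumes "0 < t"
  shows "hooks t 2 n = (\<Sum>M\<in>parts_from {s. \<not> t dvd s} (int n). mset_hooks2 M)"
proof -
  have "parts_from {s. \<not> t dvd s} (int n) = mset ` regular_partitions t n"
    unfolding regular_partitions_def by (subst parts_from_eq_image) auto
  moreover have "inj_on mset (regular_partitions t n)"
    using inj_on_mset_partitions by (rule inj_on_subset) (auto simp: regular_partitions_def)
  moreover have "hooks t 2 n = (\<Sum>p\<in>regular_partitions t n. mset_hooks2 (mset p))"
    unfolding hooks_def
    by (intro sum.cong card_hooks2_eq) (auto simp: regular_partitions_def partitions_def)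
  ultimately show ?thesis by (simp add: sum.reindex)
qed

text \<open>Double counting of the pairs related by \<open>R\<close>; it trades the sum over
  partitions for a sum over part sizes.\<close>

lemma sum_card_eq_sum_card:
  assumes "finite X" "finite S" "\<And>M s. M \<in> X \<Longrightarrow> R M s \<Longrightarrow> s \<in> S"
  shows "(\<Sum>M\<in>X. card {s. R M s}) = (\<Sum>s\<in>S. card {M \<in> X. R M s})"
proof -
  have "(\<Sum>M\<in>X. card {s. R M s}) = (\<Sum>M\<in>X. card {s \<in> S. R M s})"
    using assms(3) by (intro sum.cong arg_cong[where f = card]) auto
  also have "\<dots> = (\<Sum>s\<in>S. card {M \<in> X. R M s})"
    using assms(1,2) sum_multicount_gen[of X S "\<lambda>M s. R M s"] by simp
  finally show ?thesis .
qed

text \<open>For each size \<open>s\<close>, count the multisets containing \<open>s\<close>,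
  subtract those containing both \<open>s\<close> and \<open>s - 1\<close>, and add those containing
  \<open>s\<close> twice. By \<open>card_parts_from_superset\<close> these are shifts by
  \<open>s\<close>, \<open>2 * s - 1\<close> and \<open>2 * s\<close>.\<close>

lemma sum_mset_hooks2:
  assumes "0 \<notin> A" "n \<le> N"
  shows "int (\<Sum>M\<in>parts_from A (int n). mset_hooks2 M) =
    (\<Sum>s=2..N. if s \<in> A then num_parts A (int n - int s) else 0) -
    (\<Sum>s=2..N. if s \<in> A \<and> s - 1 \<in> A then num_parts A (int n - 2 * int s + 1) else 0) +
    (\<Sum>s=1..N. if s \<in> A then num_parts A (int n - 2 * int s) else 0)"
proof -
  let ?X = "parts_from A (int n)"
  have fin: "finite ?X" using finite_parts_from[OF assms(1)] .
  have le: "s \<le> N" and pos: "s \<noteq> 0" and A: "s \<in> A" if "M \<in> ?X" "s \<in># M" for M s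
  proof -
    have "s \<le> sum_mset M" using multi_member_split[OF that(2)] by auto
    then show "s \<le> N" using that assms(2) by (auto simp: parts_from_def)
    show "s \<in> A" using that by (auto simp: parts_from_def)
    then show "s \<noteq> 0" using assms(1) by metis
  qed
  have c1: "int (card {M \<in> ?X. s \<in># M \<and> 2 \<le> s \<and> s - 1 \<notin># M}) =
      (if s \<in> A then num_parts A (int n - int s) else 0) -
      (if s \<in> A \<and> s - 1 \<in> A then num_parts A (int n - 2 * int s + 1) else 0)"
    if "s \<in> {2..N}" for s
  proof -
    let ?P = "{M \<in> ?X. {#s#} \<subseteq># M}" and ?Q = "{M \<in> ?X. {#s, s - 1#} \<subseteq># M}"
    have sub: "{#s, s - 1#} \<subseteq># M \<longleftrightarrow> s \<in># M \<and> s - 1 \<in># M" for M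
      using that by (auto simp: insert_subset_eq_iff in_diff_count)
    have "{M \<in> ?X. s \<in># M \<and> 2 \<le> s \<and> s - 1 \<notin># M} = ?P - ?Q"
      using that sub by auto
    moreover have "?Q \<subseteq> ?P" "finite ?P" using fin sub by auto
    ultimately have "int (card {M \<in> ?X. s \<in># M \<and> 2 \<le> s \<and> s - 1 \<notin># M}) =
        int (card ?P) - int (card ?Q)"
      by (simp add: card_Diff_subset finite_subset card_mono of_nat_diff)
    moreover have "int (card ?P) = (if s \<in> A then num_parts A (int n - int s) else 0)"
    proof (cases "s \<in> A")
      case False
      then have "?P = {}" using A by auto
      then show ?thesis using False by (simp only: card.empty) simp
    qed (use card_parts_from_superset[of "{#s#}" A "int n"] in simp)
    moreover have "int (card ?Q) =
        (if s \<in> A \<and> s - 1 \<in> A then num_parts A (int n - 2 * int s + 1) else 0)"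
    proof (cases "s \<in> A \<and> s - 1 \<in> A")
      case True
      then have "set_mset {#s, s - 1#} \<subseteq> A" by simp
      from card_parts_from_superset[OF this, of "int n"]
      have "int (card ?Q) = num_parts A (int n - int (sum_mset {#s, s - 1#}))" .
      also have "int n - int (sum_mset {#s, s - 1#}) = int n - 2 * int s + 1"
        using that by auto
      finally show ?thesis using True by (simp only: if_True simp_thms)
    next
      case False
      then have "?Q = {}" using A sub by auto
      then show ?thesis using False by (simp only: card.empty) simp
    qed
    ultimately show ?thesis by simp
  qed
  have c2: "int (card {M \<in> ?X. 2 \<le> count M s}) =
      (if s \<in> A then num_parts A (int n - 2 * int s) else 0)" for s
  proof -
    have sub: "2 \<le> count M s \<longleftrightarrow> {#s, s#} \<subseteq># M" for M
      by (auto simp: subseteq_mset_def)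
    show ?thesis
    proof (cases "s \<in> A")
      case True
      have "int n - int (sum_mset {#s, s#}) = int n - 2 * int s" by simp
      then show ?thesis
        using True card_parts_from_superset[of "{#s, s#}" A "int n"] by (simp add: sub)
    next
      case False
      then have "{M \<in> ?X. 2 \<le> count M s} = {}"
        using A by (auto simp: sub dest: mset_subset_eqD)
      then show ?thesis using False by (simp only: card.empty) simp
    qed
  qed
  have "(\<Sum>M\<in>?X. mset_hooks2 M) =
      (\<Sum>M\<in>?X. card {s. s \<in># M \<and> 2 \<le> s \<and> s - 1 \<notin># M}) + (\<Sum>M\<in>?X. card {s. 2 \<le> count M s})"
    by (simp add: mset_hooks2_def sum.distrib)
  also have "(\<Sum>M\<in>?X. card {s. s \<in># M \<and> 2 \<le> s \<and> s - 1 \<notin># M}) =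
      (\<Sum>s=2..N. card {M \<in> ?X. s \<in># M \<and> 2 \<le> s \<and> s - 1 \<notin># M})"
    using fin le by (intro sum_card_eq_sum_card) auto
  also have "(\<Sum>M\<in>?X. card {s. 2 \<le> count M s}) = (\<Sum>s=1..N. card {M \<in> ?X. 2 \<le> count M s})"
  proof (intro sum_card_eq_sum_card fin)
    fix M s assume "M \<in> ?X" "2 \<le> count M s"
    moreover from this have "s \<in># M"
      unfolding count_greater_zero_iff[symmetric] by linarith
    ultimately show "s \<in> {1..N}"
      using le[of M s] pos[of M s] by auto
  qed simp
  finally have "int (\<Sum>M\<in>?X. mset_hooks2 M) =
      (\<Sum>s=2..N. int (card {M \<in> ?X. s \<in># M \<and> 2 \<le> s \<and> s - 1 \<notin># M})) +
      (\<Sum>s=1..N. int (card {M \<in> ?X. 2 \<le> count M s}))"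
    by simp
  also have "\<dots> = (\<Sum>s=2..N. (if s \<in> A then num_parts A (int n - int s) else 0) -
      (if s \<in> A \<and> s - 1 \<in> A then num_parts A (int n - 2 * int s + 1) else 0)) +
      (\<Sum>s=1..N. if s \<in> A then num_parts A (int n - 2 * int s) else 0)"
    using c1 c2 by (intro arg_cong2[where f = "(+)"] sum.cong) auto
  finally show ?thesis by (simp add: sum_subtractf)
qed

section \<open>Two injections between sets of partitions\<close>

text \<open>
  If all parts are even, one of them, \<open>b\<close>, is traded for a 5 and \<open>(b - 4) / 2\<close> twos, otherwise some
  odd part \<open>a\<close> is traded for \<open>(a - 1) / 2\<close> twos. The number of twos reveals the part removed.
\<close>

lemma num_parts_insert_2_ge:
  assumes A: "A \<subseteq> {3..}" and "5 \<in> A" and "0 < j"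
  shows "num_parts A j \<le> num_parts (insert 2 A) (j + 1) + num_parts (insert 2 A) (j - 1)"
proof -
  let ?E = "{M \<in> parts_from A j. \<forall>s\<in>#M. even s}" and ?O = "{M \<in> parts_from A j. \<not> (\<forall>s\<in>#M. even s)}"
  \<comment> \<open>Any choice of the part will do, since it can be read off from the image. The map
    \<open>f\<close> lowers the sum by 1 and \<open>g\<close> raises it by 1, whence the two terms
    of the bound.\<close>
  define a b where "a M = (SOME s. s \<in># M \<and> odd s)" and "b M = (SOME s. s \<in># M)" for M :: "nat multiset"
  define f where "f M = M - {#a M#} + replicate_mset ((a M - 1) div 2) 2" for M
  define g where "g M = M - {#b M#} + {#5#} + replicate_mset ((b M - 4) div 2) 2" for M
  \<comment> \<open>All parts in \<open>A\<close> are at least 3, so the twos in \<open>f M\<close>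
    and \<open>g M\<close> are exactly the added ones.\<close>
  have 2: "count M 2 = 0" if "M \<in> parts_from A j" for M
    using that A by (auto simp: parts_from_def not_in_iff[symmetric])
  have a: "a M \<in># M" "odd (a M)" if "M \<in> ?O" for M
    using that someI_ex[of "\<lambda>s. s \<in># M \<and> odd s"] by (auto simp: a_def)
  have b: "b M \<in># M" "even (b M)" "4 \<le> b M" if "M \<in> ?E" for M
  proof -
    have "M \<noteq> {#}" using that \<open>0 < j\<close> by (auto simp: parts_from_def)
    then show "b M \<in># M"
      using someI_ex[of "\<lambda>s. s \<in># M"] by (auto simp: b_def)
    then show "even (b M)" using that by auto
    moreover have "3 \<le> b M" using \<open>b M \<in># M\<close> that A by (auto simp: parts_from_def)
    ultimately show "4 \<le> b M" by presburger
  qed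
  have half_odd: "x = 2 * ((x - 1) div 2) + 1" if "odd x" for x :: nat
    using that by auto
  have half_even: "x = 2 * ((x - 4) div 2) + 4" if "even x" "4 \<le> x" for x :: nat
    using that by auto
  have "inj_on f ?O"
  proof (rule inj_onI)
    fix M M' assume M: "M \<in> ?O" "M' \<in> ?O" and eq: "f M = f M'"
    have "count (f M) 2 = (a M - 1) div 2" "count (f M') 2 = (a M' - 1) div 2"
      using M 2 by (auto simp: f_def)
    then have "(a M - 1) div 2 = (a M' - 1) div 2" using eq by simp
    then have "a M = a M'" using half_odd a(2)[OF M(1)] a(2)[OF M(2)] by metis
    then have "M - {#a M#} = M' - {#a M#}" using eq by (simp add: f_def)
    then have "add_mset (a M) (M - {#a M#}) = add_mset (a M') (M' - {#a M'#})"
      by (simp only: \<open>a M = a M'\<close>)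
    then show "M = M'"
      using a(1)[OF M(1)] a(1)[OF M(2)] by (simp only: insert_DiffM)
  qed
  moreover have "f ` ?O \<subseteq> parts_from (insert 2 A) (j - 1)"
  proof
    fix N assume "N \<in> f ` ?O"
    then obtain M where M: "M \<in> ?O" and N: "N = f M" by auto
    have odd: "odd (a M)" using a(2)[OF M] .
    have "N = (M - {#a M#}) + replicate_mset ((a M - 1) div 2) 2"
      using N f_def by simp
    moreover have "sum_mset M = a M + sum_mset (M - {#a M#})"
      using insert_DiffM[OF a(1)[OF M]] by (metis sum_mset.add_mset)
    moreover have "set_mset (M - {#a M#}) \<subseteq> A" "int (sum_mset M) = j"
      using M by (auto simp: parts_from_def dest: in_diffD)
    ultimately show "N \<in> parts_from (insert 2 A) (j - 1)"
      using odd by (auto simp: parts_from_def elim!: oddE)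
  qed
  moreover have "inj_on g ?E"
  proof (rule inj_onI)
    fix M M' assume M: "M \<in> ?E" "M' \<in> ?E" and eq: "g M = g M'"
    have "count (g M) 2 = (b M - 4) div 2" "count (g M') 2 = (b M' - 4) div 2"
      using M 2 by (auto simp: g_def)
    then have "(b M - 4) div 2 = (b M' - 4) div 2" using eq by simp
    then have "b M = b M'" using half_even b(2,3)[OF M(1)] b(2,3)[OF M(2)] by metis
    then have "M - {#b M#} = M' - {#b M#}" using eq by (simp add: g_def)
    then have "add_mset (b M) (M - {#b M#}) = add_mset (b M') (M' - {#b M'#})"
      by (simp only: \<open>b M = b M'\<close>)
    then show "M = M'"
      using b(1)[OF M(1)] b(1)[OF M(2)] by (simp only: insert_DiffM)
  qed
  moreover have "g ` ?E \<subseteq> parts_from (insert 2 A) (j + 1)"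
  proof
    fix N assume "N \<in> g ` ?E"
    then obtain M where M: "M \<in> ?E" and N: "N = g M" by auto
    have even: "even (b M)" "4 \<le> b M" using b(2,3)[OF M] .
    have "N = (M - {#b M#}) + {#5#} + replicate_mset ((b M - 4) div 2) 2"
      using N g_def by simp
    moreover have "sum_mset M = b M + sum_mset (M - {#b M#})"
      using insert_DiffM[OF b(1)[OF M]] by (metis sum_mset.add_mset)
    moreover have "set_mset (M - {#b M#}) \<subseteq> A" "int (sum_mset M) = j"
      using M by (auto simp: parts_from_def dest: in_diffD)
    ultimately show "N \<in> parts_from (insert 2 A) (j + 1)"
      using even \<open>5 \<in> A\<close> by (auto simp: parts_from_def elim!: evenE)
  qed
  moreover have "0 \<notin> A" "0 \<notin> insert 2 A" using A by auto
  ultimately have "card ?O \<le> card (parts_from (insert 2 A) (j - 1))"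
      "card ?E \<le> card (parts_from (insert 2 A) (j + 1))"
    by (meson card_inj_on_le finite_parts_from)+
  moreover have "card (parts_from A j) = card ?E + card ?O"
    using finite_parts_from[OF \<open>0 \<notin> A\<close>, of j]
    by (subst card_Un_disjoint[symmetric]) (auto intro: arg_cong[where f = card])
  ultimately show ?thesis by (simp add: num_parts_def)
qed

text \<open>
  Each part \<open>s\<close> divisible by 3 is split into \<open>s - 1\<close> and \<open>1\<close>; this can be undone, since the even
  parts are exactly those of the form \<open>s - 1\<close>.
\<close>

lemma num_parts_odd_le:
  "num_parts {s. \<not> 2 dvd s} i \<le> num_parts {s. \<not> 3 dvd s} i"
proof -
  define h :: "nat \<Rightarrow> nat" where "h s = (if 3 dvd s then s - 1 else s)" for s
  define f where "f M = image_mset h M + replicate_mset (size (filter_mset ((dvd) 3) M)) 1" for M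
  let ?X = "parts_from {s. \<not> 2 dvd s} i"
  define g :: "nat \<Rightarrow> nat" where "g s = (if even s then s + 1 else s)" for s
  have h: "h s = 1 \<longleftrightarrow> s = 1" "g (h s) = s" "h s + (if 3 dvd s then 1 else 0) = s" "\<not> 3 dvd h s"
    if "odd s" for s
    using that unfolding g_def h_def by presburger+
  have f_add: "f (add_mset s M) = add_mset (h s) (f M + (if 3 dvd s then {#1#} else {#}))" for s M
    by (simp add: f_def)
  have f_empty: "f {#} = {#}" by (simp add: f_def)
  have sum_f: "sum_mset (f M) = sum_mset M" if "\<forall>s\<in>#M. odd s" for M
    using that
  proof (induction M)
    case (add s M)
    then show ?case using h(3)[of s] by (simp add: f_add split: if_splits)
  qed (simp add: f_empty)
  \<comment> \<open>Parts 1 are left out because \<open>f\<close> adds further ones; their original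
    number is recovered from the sum, which \<open>f\<close> preserves.\<close>
  have recover: "image_mset g (filter_mset ((\<noteq>) 1) (f M)) = filter_mset ((\<noteq>) 1) M"
    if "\<forall>s\<in>#M. odd s" for M
    using that
  proof (induction M)
    case (add s M)
    have "odd s" using add.prems by simp
    have "image_mset g (filter_mset ((\<noteq>) 1) (f (add_mset s M))) =
        (if h s = 1 then {#} else {#g (h s)#}) + image_mset g (filter_mset ((\<noteq>) 1) (f M))"
      by (simp add: f_add)
    also have "\<dots> = (if s = 1 then {#} else {#s#}) + filter_mset ((\<noteq>) 1) M"
      using add.IH add.prems by (simp only: h[OF \<open>odd s\<close>]) simp
    also have "\<dots> = filter_mset ((\<noteq>) 1) (add_mset s M)"
      by simp
    finally show ?case .
  qed (simp add: f_empty)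
  have decomp: "M = filter_mset ((\<noteq>) 1) M + replicate_mset (count M 1) 1" for M :: "nat multiset"
    by (rule multiset_eqI) auto
  have "inj_on f ?X"
  proof (rule inj_onI)
    fix M M' assume M: "M \<in> ?X" "M' \<in> ?X" and "f M = f M'"
    have odd: "\<forall>s\<in>#M. odd s" "\<forall>s\<in>#M'. odd s" using M by (auto simp: parts_from_def)
    then have eq: "filter_mset ((\<noteq>) 1) M = filter_mset ((\<noteq>) 1) M'"
      using recover \<open>f M = f M'\<close> by metis
    have "sum_mset M = sum_mset M'"
      using M by (auto simp: parts_from_def)
    moreover have "sum_mset M = sum_mset (filter_mset ((\<noteq>) 1) M) + count M 1" for M :: "nat multiset"
      by (subst decomp, subst sum_mset.union) simp
    ultimately have "count M 1 = count M' 1" using eq by (metis add_left_cancel)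
    then show "M = M'" using eq decomp by metis
  qed
  moreover have "f ` ?X \<subseteq> parts_from {s. \<not> 3 dvd s} i"
  proof
    fix N assume "N \<in> f ` ?X"
    then obtain M where M: "M \<in> ?X" and N: "N = f M" by auto
    then have "\<forall>s\<in>#M. odd s" by (auto simp: parts_from_def)
    then have "\<forall>s\<in>#f M. \<not> 3 dvd s" "sum_mset (f M) = sum_mset M"
      using h(4) sum_f by (auto simp: f_def split: if_splits)
    then show "N \<in> parts_from {s. \<not> 3 dvd s} i"
      using M by (auto simp: N parts_from_def)
  qed
  moreover have "finite (parts_from {s. \<not> 3 dvd s} i)" by (rule finite_parts_from) simp
  ultimately show ?thesis by (simp add: num_parts_def card_inj_on_le)
qed

section \<open>Lower bounds for a block and for sums of blocks\<close>

text \<open>The coefficient of \<open>q^m\<close> in \<open>(1 - q^12) (G\<^sub>3 - G\<^sub>2) P\<^sub>3\<close>, in the notation of the introduction.\<close>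

definition block :: "int \<Rightarrow> int" where
  "block m = (let P = num_parts {s. \<not> 3 dvd s} in
     P (m - 2) - 2 * P (m - 3) + 2 * P (m - 4) - P (m - 6) + 2 * P (m - 8) - 2 * P (m - 9) + P (m - 10))"

text \<open>\<open>?R\<close> and \<open>?S\<close> are \<open>(1 - q) P\<close> and
  \<open>(1 - q^2) (1 - q) P\<close> in coefficients. The factorisation of the numerator writes the
  block as a four-term combination of \<open>?R\<close>, plus \<open>2 * ?R (m - 8)\<close> and
  \<open>?P (m - 10)\<close>; only the combination can be negative.\<close>

lemma block_ge:
  "block m \<ge> num_parts {s. \<not> 3 dvd s} (m - 10) - of_bool (m = 3)"
proof -
  let ?A = "{s. \<not> 3 dvd s} :: nat set"
  let ?P = "num_parts ?A" and ?R = "num_parts (?A - {1})" and ?S = "num_parts (?A - {1} - {2})"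
  have PR: "?P i = ?R i + ?P (i - 1)" for i
    using num_parts_remove[of ?A 1 i] by simp
  have RS: "?R i = ?S i + ?R (i - 2)" for i
    using num_parts_remove[of "?A - {1}" 2 i] by simp
  have ins: "insert 2 (?A - {1} - {2}) = ?A - {1}" by auto
  have "\<not> 3 dvd s \<Longrightarrow> s \<noteq> 1 \<Longrightarrow> s \<noteq> 2 \<Longrightarrow> 3 \<le> s" for s :: nat by presburger
  then have "?A - {1} - {2} \<subseteq> {3..}" by auto
  then have S: "?S j \<le> ?R (j + 1) + ?R (j - 1)" if "0 < j" for j
    using num_parts_insert_2_ge[of "?A - {1} - {2}" j] that ins by simp
  have "?R (m - 2) - ?R (m - 3) + ?R (m - 4) + ?R (m - 5) \<ge> - of_bool (m = 3)"
  proof (cases "m - 3" "0 :: int" rule: linorder_cases)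
    case less
    then show ?thesis using num_parts_nonneg[of "?A - {1}" "m - 2"] by (simp add: num_parts_neg)
  next
    \<comment> \<open>Here the subtracted term is \<open>?R 0\<close>, which counts at most the
      empty multiset; this is the only source of a negative value.\<close>
    case equal
    have "parts_from (?A - {1}) 0 \<subseteq> {{#}}"
    proof
      fix M assume "M \<in> parts_from (?A - {1}) 0"
      then have "\<forall>x\<in>#M. x = 0 \<and> \<not> 3 dvd x" by (auto simp: parts_from_def)
      then show "M \<in> {{#}}" by (metis dvd_0_right multiset_nonemptyE singletonI)
    qed
    then have "card (parts_from (?A - {1}) 0) \<le> 1" using card_mono[of "{{#}}"] by simp
    then have "?R 0 \<le> 1" by (simp add: num_parts_def)
    then show ?thesis using equal num_parts_nonneg[of "?A - {1}" 1] by (simp add: num_parts_neg)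
  next
    \<comment> \<open>By \<open>RS\<close> the term \<open>?R (m - 5)\<close> cancels against a part
      of \<open>?R (m - 3)\<close>. What remains to be bounded is \<open>?S (m - 3)\<close>, and
      \<open>S\<close> does this.\<close>
    case greater
    then show ?thesis using S[of "m - 3"] RS[of "m - 3"] by (simp add: algebra_simps)
  qed
  moreover have "block m = (?R (m - 2) - ?R (m - 3) + ?R (m - 4) + ?R (m - 5)) +
      2 * ?R (m - 8) + ?P (m - 10)"
    using PR[of "m - 2"] PR[of "m - 3"] PR[of "m - 4"] PR[of "m - 5"] PR[of "m - 8"]
    by (simp add: block_def)
  ultimately show ?thesis using num_parts_nonneg[of "?A - {1}" "m - 8"] by linarith
qed

text \<open>At most one \<open>k\<close> satisfies \<open>n - 12 * k = 3\<close>, and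
  \<open>n > 3\<close> excludes \<open>k = 0\<close>. Such a \<open>k\<close> forces
  \<open>n \<ge> 15\<close>, and then the term for \<open>k = 0\<close> is at least
  \<open>P (n - 10) \<ge> 1\<close>, which pays for the loss.\<close>

lemma sum_block_nonneg:
  assumes "n > 3"
  shows "(\<Sum>k<K. block (int n - 12 * int k)) \<ge> 0"
proof (cases K)
  case 0
  then show ?thesis by (simp only: lessThan_0 sum.empty)
next
  case (Suc L)
  have "(\<Sum>k<L. block (int n - 12 * int (Suc k))) \<ge> (\<Sum>k<L. - of_bool (int n = 3 + 12 * int (Suc k)))"
  proof (rule sum_mono)
    fix k
    have "int n - 12 * int (Suc k) = 3 \<longleftrightarrow> int n = 3 + 12 * int (Suc k)" by linarith
    then show "block (int n - 12 * int (Suc k)) \<ge> - of_bool (int n = 3 + 12 * int (Suc k))"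
      using block_ge[of "int n - 12 * int (Suc k)"]
        num_parts_nonneg[of "{s. \<not> 3 dvd s}" "int n - 12 * int (Suc k) - 10"]
      by (simp only:)
  qed
  moreover have "(\<Sum>k<L. - of_bool (int n = 3 + 12 * int (Suc k)) :: int) \<ge> - of_bool (15 \<le> n)"
  proof -
    let ?S = "{..<L} \<inter> {k. int n = 3 + 12 * int (Suc k)}"
    have "15 \<le> n \<and> k = (n - 15) div 12" if "k \<in> ?S" for k
    proof -
      have "n = 15 + 12 * k" using that by simp
      then show ?thesis by simp
    qed
    then have sub: "?S \<subseteq> (if 15 \<le> n then {(n - 15) div 12} else {})"
      by (auto simp only: if_True if_False split: if_split)
    have "int (card ?S) \<le> of_bool (15 \<le> n)"
      using card_mono[OF _ sub] by (cases "15 \<le> n") auto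
    moreover have "(\<Sum>k<L. - of_bool (int n = 3 + 12 * int (Suc k)) :: int) = - int (card ?S)"
      by (simp add: sum_negf sum_of_bool_eq del: of_nat_Suc)
    ultimately show ?thesis by linarith
  qed
  moreover have "block (int n) \<ge> of_bool (15 \<le> n)"
    using block_ge[of "int n"] assms num_parts_pos[of "{s. \<not> 3 dvd s}" "int n - 10"]
      num_parts_nonneg[of "{s. \<not> 3 dvd s}" "int n - 10"]
    by (cases "15 \<le> n") auto
  moreover have "(\<Sum>k<K. block (int n - 12 * int k)) =
      block (int n) + (\<Sum>k<L. block (int n - 12 * int (Suc k)))"
    unfolding Suc sum.lessThan_Suc_shift by (simp only: of_nat_0 mult_zero_right diff_zero)
  ultimately show ?thesis by linarith
qed

section \<open>Cutting the hook sums into blocks\<close>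

lemma sum_append_block:
  fixes f :: "nat \<Rightarrow> int"
  shows "(\<Sum>s=a..<m * Suc K + a. f s) = (\<Sum>s=a..<m * K + a. f s) + (\<Sum>j=a..<m + a. f (m * K + j))"
proof -
  have "(\<Sum>s=a..<m * Suc K + a. f s) = (\<Sum>s=a..<m * K + a. f s) + (\<Sum>s=m * K + a..<m * K + (m + a). f s)"
    by (subst sum.atLeastLessThan_concat) (auto simp: algebra_simps)
  also have "(\<Sum>s=m * K + a..<m * K + (m + a). f s) = (\<Sum>j=a..<m + a. f (m * K + j))"
    using sum.shift_bounds_nat_ivl[of f a "m * K" "m + a"] by (simp add: add.commute)
  finally show ?thesis .
qed

text \<open>Divisibility by 2 and by 3 has period 6 in \<open>s\<close>. Twelve values of
  \<open>s\<close> in the sums with shift \<open>s\<close>, and six in those with shift about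
  \<open>2 * s\<close>, both advance the argument by 12, so each induction step contributes one
  block. The sums for 2-regular partitions already carry \<open>P\<close> for 3, since they are
  compared after that replacement.\<close>

lemma sum_eq_sum_block:
  fixes n K :: nat
  defines "P \<equiv> num_parts {s. \<not> 3 dvd s}"
  shows "(\<Sum>s=2..<12 * K + 2. if \<not> 3 dvd s then P (int n - int s) else 0) -
    (\<Sum>s=2..<6 * K + 2. if \<not> 3 dvd s \<and> \<not> 3 dvd s - 1 then P (int n - 2 * int s + 1) else 0) +
    (\<Sum>s=1..<6 * K + 1. if \<not> 3 dvd s then P (int n - 2 * int s) else 0) -
    ((\<Sum>s=2..<12 * K + 2. if \<not> 2 dvd s then P (int n - int s) else 0) +
     (\<Sum>s=1..<6 * K + 1. if \<not> 2 dvd s then P (int n - 2 * int s) else 0)) =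
    (\<Sum>k<K. block (int n - 12 * int k))"
proof (induction K)
  case (Suc K)
  define m where "m = int n - 12 * int K"
  have dvd: "3 dvd 12 * K + c \<longleftrightarrow> 3 dvd c" "2 dvd 12 * K + c \<longleftrightarrow> 2 dvd c"
    "3 dvd 6 * K + c \<longleftrightarrow> 3 dvd c" "2 dvd 6 * K + c \<longleftrightarrow> 2 dvd c" for c
    by presburger+
  \<comment> \<open>Subtraction on naturals is harmless here because \<open>j\<close> is at least
    2.\<close>
  have pred: "6 * K + j - 1 = 6 * K + (j - 1)" if "j \<in> {2..<6 + 2}" for j
    using that by auto
  have ivl: "{2..<12 + 2} = {2, 3, 4, 5, 6, 7, 8, 9, 10, 11, 12, 13::nat}"
    "{2..<6 + 2} = {2, 3, 4, 5, 6, 7::nat}" "{1..<6 + 1} = {1, 2, 3, 4, 5, 6::nat}"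
    by (auto; arith)+
  have int: "int n - int (12 * K + j) = m - int j" "int n - 2 * int (6 * K + j) = m - 2 * int j" for j
    by (simp_all add: m_def)
  have sums: "(\<Sum>j=2..<12 + 2. if \<not> 3 dvd 12 * K + j then P (int n - int (12 * K + j)) else 0) =
      P (m - 2) + P (m - 4) + P (m - 5) + P (m - 7) + P (m - 8) + P (m - 10) + P (m - 11) + P (m - 13)"
    "(\<Sum>j=2..<12 + 2. if \<not> 2 dvd 12 * K + j then P (int n - int (12 * K + j)) else 0) =
      P (m - 3) + P (m - 5) + P (m - 7) + P (m - 9) + P (m - 11) + P (m - 13)"
    "(\<Sum>j=1..<6 + 1. if \<not> 3 dvd 6 * K + j then P (int n - 2 * int (6 * K + j)) else 0) =
      P (m - 2) + P (m - 4) + P (m - 8) + P (m - 10)"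
    "(\<Sum>j=1..<6 + 1. if \<not> 2 dvd 6 * K + j then P (int n - 2 * int (6 * K + j)) else 0) =
      P (m - 2) + P (m - 6) + P (m - 10)"
    unfolding int dvd ivl by simp_all
  have "(\<Sum>j=2..<6 + 2. if \<not> 3 dvd 6 * K + j \<and> \<not> 3 dvd 6 * K + j - 1
      then P (int n - 2 * int (6 * K + j) + 1) else 0) =
    (\<Sum>j=2..<6 + 2. if \<not> 3 dvd j \<and> \<not> 3 dvd j - 1 then P (m - 2 * int j + 1) else 0)"
    by (intro sum.cong refl) (simp only: int dvd pred)
  \<comment> \<open>Only \<open>j = 2\<close> and \<open>j = 5\<close> survive, giving the shifts
    \<open>2 * j - 1\<close>, that is 3 and 9.\<close>
  also have "\<dots> = P (m - 3) + P (m - 9)"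
    unfolding ivl by simp
  finally have pairs: "(\<Sum>j=2..<6 + 2. if \<not> 3 dvd 6 * K + j \<and> \<not> 3 dvd 6 * K + j - 1
      then P (int n - 2 * int (6 * K + j) + 1) else 0) = P (m - 3) + P (m - 9)" .
  have "block m = P (m - 2) - 2 * P (m - 3) + 2 * P (m - 4) - P (m - 6) + 2 * P (m - 8) -
      2 * P (m - 9) + P (m - 10)"
    by (simp only: block_def Let_def P_def)
  then show ?case
    unfolding sum_append_block sums pairs sum.lessThan_Suc m_def[symmetric]
    using Suc.IH by linarith
qed simp

text \<open>The limits are those of \<open>sum_eq_sum_block\<close> with \<open>K = n\<close>. They
  exceed what is needed, but every term beyond the true range has a negative argument and
  vanishes.\<close>

lemma int_hooks2_eq:
  assumes "0 < t"
  defines "P \<equiv> num_parts {s. \<not> t dvd s}"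
  shows "int (hooks t 2 n) =
    (\<Sum>s=2..<12 * n + 2. if \<not> t dvd s then P (int n - int s) else 0) -
    (\<Sum>s=2..<6 * n + 2. if \<not> t dvd s \<and> \<not> t dvd s - 1 then P (int n - 2 * int s + 1) else 0) +
    (\<Sum>s=1..<6 * n + 1. if \<not> t dvd s then P (int n - 2 * int s) else 0)"
proof -
  have 1: "(\<Sum>s=2..12 * n + 1. if \<not> t dvd s \<and> \<not> t dvd s - 1 then num_parts {s. \<not> t dvd s} (int n - 2 * int s + 1) else 0) =
      (\<Sum>s=2..<6 * n + 2. if \<not> t dvd s \<and> \<not> t dvd s - 1 then num_parts {s. \<not> t dvd s} (int n - 2 * int s + 1) else 0)"
    by (rule sum.mono_neutral_right) (auto intro!: num_parts_neg)
  have 2: "(\<Sum>s=1..12 * n + 1. if \<not> t dvd s then num_parts {s. \<not> t dvd s} (int n - 2 * int s) else 0) =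
      (\<Sum>s=1..<6 * n + 1. if \<not> t dvd s then num_parts {s. \<not> t dvd s} (int n - 2 * int s) else 0)"
    by (rule sum.mono_neutral_right) (auto intro!: num_parts_neg)
  have 3: "{2..<12 * n + 2} = {2..12 * n + 1}" by auto
  have "0 \<notin> {s. \<not> t dvd s}" "n \<le> 12 * n + 1" by simp_all
  from sum_mset_hooks2[OF this] show ?thesis
    unfolding mem_Collect_eq hooks2_eq_sum[OF assms(1)] P_def 1 2 3 .
qed

theorem theorem1p2:
  fixes n :: nat
  assumes "n > 3"
  shows "hooks 3 2 n \<ge> hooks 2 2 n"
proof -
  let ?P2 = "num_parts {s. \<not> 2 dvd s}" and ?P3 = "num_parts {s. \<not> 3 dvd s}"
  \<comment> \<open>Two consecutive numbers are never both odd, so the subtracted sum is zero for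
    \<open>t = 2\<close>. All remaining terms have a positive sign, which permits replacing
    \<open>?P2\<close> by the larger \<open>?P3\<close> term by term.\<close>
  have "\<not> (\<not> 2 dvd s \<and> \<not> 2 dvd s - 1)" for s :: nat by presburger
  then have "int (hooks 2 2 n) =
      (\<Sum>s=2..<12 * n + 2. if \<not> 2 dvd s then ?P2 (int n - int s) else 0) +
      (\<Sum>s=1..<6 * n + 1. if \<not> 2 dvd s then ?P2 (int n - 2 * int s) else 0)"
    using int_hooks2_eq[of 2 n] by (simp only: if_False sum.neutral_const)
  also have "\<dots> \<le> (\<Sum>s=2..<12 * n + 2. if \<not> 2 dvd s then ?P3 (int n - int s) else 0) +
      (\<Sum>s=1..<6 * n + 1. if \<not> 2 dvd s then ?P3 (int n - 2 * int s) else 0)"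
    using num_parts_odd_le by (intro add_mono sum_mono) auto
  also have "\<dots> = int (hooks 3 2 n) - (\<Sum>k<n. block (int n - 12 * int k))"
    using sum_eq_sum_block[where n = n and K = n] int_hooks2_eq[of 3 n] by linarith
  also have "\<dots> \<le> int (hooks 3 2 n)"
    using sum_block_nonneg[OF assms] by simp
  finally show ?thesis by simp
qed

end
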